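(* Let $c_0,c_1\in\mathbb R$ and $\mu>0$. For $f\in\mathcal S^1_\mu$ and $x_0\in\mathbb R^n$, consider the solution $X_t=X(t)$, $t\ge0$, of $$\ddot X_t+c_1\sqrt\mu\,\dot X_t+c_0\nabla f(X_t)=0,\qquad X(0)=x_0,\quad \dot X(0)=0.$$ (a) If $c_0>0$ and $c_1>0$, then for every $f\in\mathcal S^1_\mu$ and $x_0\in\mathbb R^n$, $$f(X_t)-f^*=O\big(e^{-C\sqrt\mu\,t}(f(x_0)-f^* )\big),\qquad C=\frac{c_1-\sqrt{\max(c_1^2-4c_0,0)}}{2}>0,$$ that is, there is a constant $C'>0$ depending only on $(c_0,c_1)$ such that $f(X_t)-f^*\le C'e^{-C\sqrt\mu\,t}(f(x_0)-f^* )$ for all $t\ge0$. (b) Otherwise (either $c_0\le0$ or $c_1\le0$), $X_t$ may fail to converge to $x^*$ as $t\to\infty$: there exist $f\in\mathcal S^1_\mu$ and $x_0$ for which $X_t\not\to x^*$ as $t\to\infty$.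
   Context: $\mathcal S^1_\mu$ is the set of continuously differentiable functions $f:\mathbb R^n\to\mathbb R$ that are $\mu$-strongly convex: $f(y)\ge f(x)+\langle\nabla f(x),y-x\rangle+\frac\mu2\|y-x\|^2$ for all $x,y\in\mathbb R^n$. $x^*$ is the unique minimizer of $f$ and $f^*=f(x^* )$. By a solution we mean a twice differentiable function on $[0,\infty)$ satisfying the ODE and initial conditions. *)

theory Defs
  imports "HOL-Analysis.Analysis"
begin

text \<open>
  The constant in the convergence estimate may depend on nothing but the two coefficients of the
  ODE; in particular it is uniform in the dimension \<open>n\<close>, so \<open>n\<close> has to be quantified inside the
  formula and cannot be the cardinality of an index type. Hence \<open>\<real>\<^sup>n\<close> is the subspace of the
  sequences supported in \<open>{..<n}\<close> within the inner product space of all finitely supported real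
  sequences. The lemma \<open>Rn_isometric_vec\<close> below identifies this subspace with \<^typ>\<open>real^'n\<close>.
\<close>

typedef fin_seq = "{x :: nat \<Rightarrow> real. finite {i. x i \<noteq> 0}}"
  morphisms coord Abs_fin_seq
  by (rule exI[of _ "\<lambda>_. 0"]) simp

setup_lifting type_definition_fin_seq

lemma finite_coord [simp]: "finite {i. coord x i \<noteq> 0}"
  using coord[of x] by simp

lemma fin_seq_eqI: "(\<And>i. coord x i = coord y i) \<Longrightarrow> x = y"
  by (simp add: coord_inject[symmetric] fun_eq_iff)

instantiation fin_seq :: real_vector
begin

lift_definition zero_fin_seq :: fin_seq is "\<lambda>_. 0" by simp

lift_definition plus_fin_seq :: "fin_seq \<Rightarrow> fin_seq \<Rightarrow> fin_seq" is "\<lambda>x y i. x i + y i"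
  subgoal for x y
    by (rule finite_subset[of _ "{i. x i \<noteq> 0} \<union> {i. y i \<noteq> 0}"]) auto
  done

lift_definition minus_fin_seq :: "fin_seq \<Rightarrow> fin_seq \<Rightarrow> fin_seq" is "\<lambda>x y i. x i - y i"
  subgoal for x y
    by (rule finite_subset[of _ "{i. x i \<noteq> 0} \<union> {i. y i \<noteq> 0}"]) auto
  done

lift_definition uminus_fin_seq :: "fin_seq \<Rightarrow> fin_seq" is "\<lambda>x i. - x i"
  by simp

lift_definition scaleR_fin_seq :: "real \<Rightarrow> fin_seq \<Rightarrow> fin_seq" is "\<lambda>a x i. a * x i"
  by (rule finite_subset) auto

instance
  by standard (transfer; simp add: algebra_simps)+

end

lemma coord_simps [simp]:
  "coord 0 i = 0"
  "coord (x + y) i = coord x i + coord y i"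
  "coord (x - y) i = coord x i - coord y i"
  "coord (- x) i = - coord x i"
  "coord (a *\<^sub>R x) i = a * coord x i"
  by (transfer; simp)+

instantiation fin_seq :: real_inner
begin

definition inner_fin_seq :: "fin_seq \<Rightarrow> fin_seq \<Rightarrow> real"
  where "inner_fin_seq x y = (\<Sum>i | coord x i \<noteq> 0. coord x i * coord y i)"

definition norm_fin_seq :: "fin_seq \<Rightarrow> real"
  where "norm_fin_seq x = sqrt (inner x x)"

definition sgn_fin_seq :: "fin_seq \<Rightarrow> fin_seq"
  where "sgn_fin_seq x = x /\<^sub>R norm x"

definition dist_fin_seq :: "fin_seq \<Rightarrow> fin_seq \<Rightarrow> real"
  where "dist_fin_seq x y = norm (x - y)"

definition uniformity_fin_seq :: "(fin_seq \<times> fin_seq) filter"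
  where "uniformity_fin_seq = (INF e\<in>{0<..}. principal {(x, y). dist x y < e})"

definition open_fin_seq :: "fin_seq set \<Rightarrow> bool"
  where "open_fin_seq U \<longleftrightarrow> (\<forall>x\<in>U. eventually (\<lambda>(x', y). x' = x \<longrightarrow> y \<in> U) uniformity)"

lemma inner_fin_seq_superset:
  assumes "finite A" "{i. coord x i \<noteq> 0} \<subseteq> A"
  shows "inner x y = (\<Sum>i\<in>A. coord x i * coord y i)"
  unfolding inner_fin_seq_def by (rule sum.mono_neutral_left) (use assms in auto)

instance
proof
  fix x y z :: fin_seq and r :: real
  let ?A = "{i. coord x i \<noteq> 0} \<union> {i. coord y i \<noteq> 0}"
  have A: "finite ?A" by simp
  show "inner x y = inner y x"
    using inner_fin_seq_superset[OF A, of x y] inner_fin_seq_superset[OF A, of y x]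
    by (simp add: mult.commute)
  have "{i. coord (x + y) i \<noteq> 0} \<subseteq> ?A" by auto
  then show "inner (x + y) z = inner x z + inner y z"
    using inner_fin_seq_superset[OF A, of x z] inner_fin_seq_superset[OF A, of y z]
      inner_fin_seq_superset[OF A, of "x + y" z]
    by (simp add: algebra_simps sum.distrib)
  have "{i. coord (r *\<^sub>R x) i \<noteq> 0} \<subseteq> ?A" by auto
  then show "inner (r *\<^sub>R x) y = r * inner x y"
    using inner_fin_seq_superset[OF A, of x y] inner_fin_seq_superset[OF A, of "r *\<^sub>R x" y]
    by (simp add: algebra_simps sum_distrib_left)
  show "0 \<le> inner x x"
    unfolding inner_fin_seq_def by (rule sum_nonneg) simp
  show "inner x x = 0 \<longleftrightarrow> x = 0"
  proof
    assume "inner x x = 0"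
    then have "\<forall>i\<in>{i. coord x i \<noteq> 0}. coord x i * coord x i = 0"
      unfolding inner_fin_seq_def by (subst (asm) sum_nonneg_eq_0_iff) auto
    then show "x = 0" by (intro fin_seq_eqI) auto
  qed (simp add: inner_fin_seq_def)
qed (simp_all add: norm_fin_seq_def sgn_fin_seq_def dist_fin_seq_def
      uniformity_fin_seq_def open_fin_seq_def)

end

definition Rn :: "nat \<Rightarrow> fin_seq set"
  where "Rn n = {x. \<forall>i\<ge>n. coord x i = 0}"

lemma subspace_Rn: "subspace (Rn n)"
  by (simp add: subspace_def Rn_def)

lemma inner_Rn: "x \<in> Rn n \<Longrightarrow> inner x y = (\<Sum>i<n. coord x i * coord y i)"
  by (rule inner_fin_seq_superset) (auto simp: Rn_def not_le[symmetric])

lemma norm_Rn: "x \<in> Rn n \<Longrightarrow> norm x = L2_set (coord x) {..<n}"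
  by (simp add: norm_eq_sqrt_inner inner_Rn L2_set_def power2_eq_square)

lemma Rn_isometric_vec:
  "\<exists>\<phi> :: real^'n \<Rightarrow> fin_seq. linear \<phi> \<and> bij_betw \<phi> UNIV (Rn CARD('n)) \<and>
     (\<forall>x y. inner (\<phi> x) (\<phi> y) = inner x y)"
proof -
  let ?N = "CARD('n)"
  obtain e :: "nat \<Rightarrow> 'n" where e: "bij_betw e {..<?N} UNIV"
    using ex_bij_betw_nat_finite[of "UNIV :: 'n set"] by (auto simp: atLeast0LessThan)
  define \<phi> :: "real^'n \<Rightarrow> fin_seq"
    where "\<phi> x = Abs_fin_seq (\<lambda>i. if i < ?N then x $ e i else 0)" for x
  have c: "coord (\<phi> x) i = (if i < ?N then x $ e i else 0)" for x i
    unfolding \<phi>_def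
    by (subst Abs_fin_seq_inverse) (auto intro: finite_subset[of _ "{..<?N}"])
  have R: "\<phi> x \<in> Rn ?N" for x by (simp add: Rn_def c)
  have lin: "linear \<phi>"
    by (intro linearI fin_seq_eqI) (auto simp: c)
  have inn: "inner (\<phi> x) (\<phi> y) = inner x y" for x y
    using sum.reindex_bij_betw[OF e, of "\<lambda>k. x $ k * y $ k"]
    by (simp add: inner_Rn[OF R] c inner_vec_def)
  have "inj \<phi>"
  proof (rule linear_injective_0[OF lin, THEN iffD2], safe)
    fix x assume "\<phi> x = 0"
    then show "x = 0" using inn[of x x] by simp
  qed
  moreover have "y \<in> range \<phi>" if y: "y \<in> Rn ?N" for y
  proof
    show "y = \<phi> (\<chi> k. coord y (inv_into {..<?N} e k))"
      by (rule fin_seq_eqI)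
        (use y e in \<open>auto simp: c Rn_def bij_betw_def inv_into_f_f\<close>)
  qed simp
  ultimately have "bij_betw \<phi> UNIV (Rn ?N)"
    using R by (auto simp: bij_betw_def)
  with lin inn show ?thesis by blast
qed

definition has_gradient :: "nat \<Rightarrow> (fin_seq \<Rightarrow> real) \<Rightarrow> fin_seq \<Rightarrow> fin_seq \<Rightarrow> bool"
  where "has_gradient n f x g \<longleftrightarrow>
    g \<in> Rn n \<and> (f has_derivative (\<lambda>h. inner g h)) (at x within Rn n)"

definition grad :: "nat \<Rightarrow> (fin_seq \<Rightarrow> real) \<Rightarrow> fin_seq \<Rightarrow> fin_seq"
  where "grad n f x = (THE g. has_gradient n f x g)"

lemma has_gradient_unique:
  assumes x: "x \<in> Rn n" and g: "has_gradient n f x g" and g': "has_gradient n f x g'"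
  shows "g = g'"
proof -
  let ?h = "g - g'"
  have h: "?h \<in> Rn n"
    using g g' subspace_diff[OF subspace_Rn] by (auto simp: has_gradient_def)
  have D: "((\<lambda>t. f (x + t *\<^sub>R ?h)) has_derivative (\<lambda>t. inner k (t *\<^sub>R ?h))) (at 0)"
    if "has_gradient n f x k" for k
  proof -
    have sub: "(\<lambda>t. x + t *\<^sub>R ?h) ` UNIV \<subseteq> Rn n"
      using x h by (auto intro!: subspace_add[OF subspace_Rn] subspace_scale[OF subspace_Rn])
    have 1: "((\<lambda>t. x + t *\<^sub>R ?h) has_derivative (\<lambda>t. t *\<^sub>R ?h)) (at 0 within UNIV)"
      by (auto intro!: derivative_eq_intros)
    have 2: "(f has_derivative inner k)
        (at (x + 0 *\<^sub>R ?h) within (\<lambda>t. x + t *\<^sub>R ?h) ` UNIV)"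
      using that by (auto simp: has_gradient_def intro: has_derivative_subset[OF _ sub])
    show ?thesis using has_derivative_in_compose[OF 1 2] by simp
  qed
  have "(\<lambda>t. inner g (t *\<^sub>R ?h)) = (\<lambda>t. inner g' (t *\<^sub>R ?h))"
    using D[OF g] D[OF g'] by (rule has_derivative_unique)
  from fun_cong[OF this, of 1] have "inner ?h ?h = 0" by (simp add: inner_diff_left)
  then show ?thesis by simp
qed

lemma grad_eq: "x \<in> Rn n \<Longrightarrow> has_gradient n f x g \<Longrightarrow> grad n f x = g"
  unfolding grad_def by (blast intro: the_equality has_gradient_unique)

definition C1 :: "nat \<Rightarrow> (fin_seq \<Rightarrow> real) \<Rightarrow> bool"
  where "C1 n f \<longleftrightarrow>
    (\<forall>x\<in>Rn n. \<exists>g. has_gradient n f x g) \<and> continuous_on (Rn n) (grad n f)"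

definition S1 :: "nat \<Rightarrow> real \<Rightarrow> (fin_seq \<Rightarrow> real) set"
  where "S1 n \<mu> = {f. C1 n f \<and>
    (\<forall>x\<in>Rn n. \<forall>y\<in>Rn n.
      f y \<ge> f x + inner (grad n f x) (y - x) + \<mu> / 2 * (norm (y - x))\<^sup>2)}"

text \<open>The derivatives at \<open>t = 0\<close> are one-sided.\<close>

definition is_solution ::
  "nat \<Rightarrow> real \<Rightarrow> real \<Rightarrow> real \<Rightarrow> (fin_seq \<Rightarrow> real) \<Rightarrow> fin_seq \<Rightarrow> (real \<Rightarrow> fin_seq) \<Rightarrow> bool"
  where "is_solution n c\<^sub>0 c\<^sub>1 \<mu> f x\<^sub>0 X \<longleftrightarrow>
    (\<forall>t\<ge>0. X t \<in> Rn n) \<and>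
    (\<exists>X' X''.
      (\<forall>t\<ge>0. (X has_vector_derivative X' t) (at t within {0..})) \<and>
      (\<forall>t\<ge>0. (X' has_vector_derivative X'' t) (at t within {0..})) \<and>
      (\<forall>t\<ge>0. X'' t + (c\<^sub>1 * sqrt \<mu>) *\<^sub>R X' t + c\<^sub>0 *\<^sub>R grad n f (X t) = 0) \<and>
      X 0 = x\<^sub>0 \<and> X' 0 = 0)"

definition decay_rate :: "real \<Rightarrow> real \<Rightarrow> real"
  where "decay_rate c\<^sub>0 c\<^sub>1 = (c\<^sub>1 - sqrt (max (c\<^sub>1\<^sup>2 - 4 * c\<^sub>0) 0)) / 2"

text \<open>
  The minimizer \<open>x\<^sup>*\<close> of \<open>f\<close> over \<open>\<real>\<^sup>n\<close>; it exists and is unique for \<open>f \<in> S1 n \<mu>\<close> with \<open>\<mu> > 0\<close>.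
\<close>

abbreviation minimizer :: "nat \<Rightarrow> (fin_seq \<Rightarrow> real) \<Rightarrow> fin_seq"
  where "minimizer n f \<equiv> arg_min_on f (Rn n)"

end

theory Submission
  imports Defs
begin

text \<open>
  With \<open>m = sqrt \<mu>\<close>, \<open>l = decay_rate c\<^sub>0 c\<^sub>1\<close> and \<open>y = X - x\<^sup>*\<close>, the function
  \<open>E = c\<^sub>0 (f(X) - f\<^sup>*) + |X' + l m y|\<^sup>2 / 2 + l (c\<^sub>1 - 2 l) m\<^sup>2 |y|\<^sup>2 / 2\<close> satisfies
  \<open>E' \<le> - l m E\<close>: the coefficient \<open>l (c\<^sub>1 - 2 l)\<close> is the one for which the products of \<open>y\<close>
  and \<open>X'\<close> cancel, and what remains is nonpositive because \<open>2 l \<le> c\<^sub>1\<close> and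
  \<open>l (c\<^sub>1 - l) \<le> c\<^sub>0\<close>. These two inequalities also give \<open>E \<ge> c\<^sub>0 (f(X) - f\<^sup>*)\<close> and, through
  strong convexity, \<open>E(0) \<le> 2 c\<^sub>0 (f(x\<^sub>0) - f\<^sup>*)\<close>.

  If \<open>c\<^sub>0 \<le> 0\<close> or \<open>c\<^sub>1 \<le> 0\<close>, a quadratic \<open>f(x) = L |x|\<^sup>2 / 2\<close> turns the equation into a linear
  one with constant coefficients, whose solution is explicit. For \<open>c\<^sub>0 > 0\<close> the curvature
  \<open>L \<ge> \<mu>\<close> is taken so large that the solution oscillates.
\<close>

section \<open>Exponential comparison and uniqueness for linear equations\<close>

text \<open>The integrating factor \<open>exp (- k * s)\<close> turns the hypothesis into a
  nonpositive derivative, so the mean value theorem applies. The sign of \<open>k\<close> is free: a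
  positive \<open>k\<close> yields uniqueness below, a negative one yields decay of the Lyapunov
  function.\<close>

lemma gronwall_exp_bound:
  fixes z z' :: "real \<Rightarrow> real"
  assumes z: "\<And>s. s \<ge> 0 \<Longrightarrow> (z has_real_derivative z' s) (at s within {0..})"
    and le: "\<And>s. s \<ge> 0 \<Longrightarrow> z' s \<le> k * z s"
    and t: "t \<ge> 0"
  shows "z t \<le> exp (k * t) * z 0"
proof (cases "t = 0")
  case False
  define w where "w s = exp (- k * s) * z s" for s
  have w: "(w has_derivative (\<lambda>h. (exp (- k * s) * (z' s - k * z s)) * h)) (at s within {0..t})"
    if "0 \<le> s" for s
  proof -
    have "(w has_real_derivative exp (- k * s) * (z' s - k * z s)) (at s within {0..t})"
      unfolding w_def
      by (rule derivative_eq_intros DERIV_subset[OF z[OF that]] refl)+ (auto simp: algebra_simps)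
    then show ?thesis by (simp add: has_field_derivative_def)
  qed
  obtain s where s: "s \<in> {0<..<t}"
    and eq: "w t - w 0 = (exp (- k * s) * (z' s - k * z s)) * (t - 0)"
    using mvt_simple[of 0 t w "\<lambda>s h. (exp (- k * s) * (z' s - k * z s)) * h"] w t False
    by fastforce
  have "w t - w 0 \<le> 0"
    unfolding eq using s le[of s] by (intro mult_nonpos_nonneg mult_nonneg_nonpos) auto
  then have "exp (- k * t) * z t \<le> z 0" by (simp add: w_def)
  then have "exp (k * t) * (exp (- k * t) * z t) \<le> exp (k * t) * z 0"
    by (intro mult_left_mono) auto
  then show ?thesis
    by (simp add: mult.assoc[symmetric] exp_add[symmetric])
qed simp

text \<open>Uniqueness for the linear equation: |D|^2 + |D'|^2 starts at 0 and grows at most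
  exponentially. It carries nonconvergence from one explicit solution to every solution.\<close>

lemma damped_linear_ode_zero:
  fixes D D' D'' :: "real \<Rightarrow> 'a::real_inner"
  assumes D: "\<And>t. t \<ge> 0 \<Longrightarrow> (D has_vector_derivative D' t) (at t within {0..})"
    and D': "\<And>t. t \<ge> 0 \<Longrightarrow> (D' has_vector_derivative D'' t) (at t within {0..})"
    and eq: "\<And>t. t \<ge> 0 \<Longrightarrow> D'' t + b *\<^sub>R D' t + c *\<^sub>R D t = 0"
    and init: "D 0 = 0" "D' 0 = 0"
    and t: "t \<ge> 0"
  shows "D t = 0"
proof -
  \<comment> \<open>After elimination of \<open>D''\<close>, the damping contributes
    \<open>2 * \<bar>b\<bar>\<close>, and the products of \<open>D\<close> and \<open>D'\<close>
    contribute \<open>\<bar>1 - c\<bar>\<close>.\<close>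
  define k where "k = 2 * \<bar>b\<bar> + \<bar>1 - c\<bar>"
  define z where "z s = inner (D s) (D s) + inner (D' s) (D' s)" for s
  have "(z has_real_derivative 2 * inner (D s) (D' s) + 2 * inner (D' s) (D'' s)) (at s within {0..})"
    if "s \<ge> 0" for s
    using D[OF that] D'[OF that]
    unfolding z_def has_vector_derivative_def has_field_derivative_def
    by (auto intro!: derivative_eq_intros simp: inner_commute algebra_simps)
  moreover have "2 * inner (D s) (D' s) + 2 * inner (D' s) (D'' s) \<le> k * z s" if "s \<ge> 0" for s
  proof -
    have "D'' s = - (b *\<^sub>R D' s) - c *\<^sub>R D s"
      using eq[OF that] by (simp add: algebra_simps eq_neg_iff_add_eq_0)
    then have "2 * inner (D s) (D' s) + 2 * inner (D' s) (D'' s)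
        = (1 - c) * (2 * inner (D s) (D' s)) + (- 2 * b) * inner (D' s) (D' s)"
      by (simp add: inner_diff_right inner_commute[of "D' s" "D s"] left_diff_distrib)
    also have "(1 - c) * (2 * inner (D s) (D' s)) \<le> \<bar>1 - c\<bar> * z s"
    proof -
      have "\<bar>2 * inner (D s) (D' s)\<bar> \<le> z s"
        using inner_ge_zero[of "D s - D' s"] inner_ge_zero[of "D s + D' s"]
        unfolding z_def by (simp add: algebra_simps inner_commute abs_le_iff)
      then show ?thesis
        by (metis abs_ge_self abs_mult abs_ge_zero mult_left_mono order_trans)
    qed
    also have "(- 2 * b) * inner (D' s) (D' s) \<le> (2 * \<bar>b\<bar>) * z s"
      unfolding z_def by (rule mult_mono) auto
    finally show ?thesis by (simp add: k_def algebra_simps)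
  qed
  ultimately have "z t \<le> exp (k * t) * z 0"
    using t by (rule gronwall_exp_bound)
  then have "z t \<le> 0" by (simp add: z_def init)
  then show ?thesis
    unfolding z_def by (smt (verit) inner_ge_zero inner_eq_zero_iff)
qed

subsection \<open>Strongly convex functions\<close>

lemma S1_C1: "f \<in> S1 n \<mu> \<Longrightarrow> C1 n f"
  by (simp add: S1_def)

lemma S1_lower_bound:
  "f \<in> S1 n \<mu> \<Longrightarrow> x \<in> Rn n \<Longrightarrow> y \<in> Rn n \<Longrightarrow>
    f x + inner (grad n f x) (y - x) + \<mu> / 2 * (norm (y - x))\<^sup>2 \<le> f y"
  by (simp add: S1_def)

lemma C1_has_derivative:
  assumes "C1 n f" "x \<in> Rn n"
  shows "(f has_derivative inner (grad n f x)) (at x within Rn n)"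
proof -
  obtain g where g: "has_gradient n f x g" using assms by (auto simp: C1_def)
  with grad_eq[OF assms(2) g] show ?thesis by (simp add: has_gradient_def)
qed

lemma C1_continuous_on: "C1 n f \<Longrightarrow> continuous_on (Rn n) f"
  by (rule has_derivative_continuous_on) (rule C1_has_derivative)

definition unit_seq :: "nat \<Rightarrow> fin_seq"
  where "unit_seq k = Abs_fin_seq (\<lambda>i. if i = k then 1 else 0)"

lemma coord_unit_seq: "coord (unit_seq k) i = (if i = k then 1 else 0)"
  unfolding unit_seq_def by (subst Abs_fin_seq_inverse) auto

lemma abs_coord_le_norm: "\<bar>coord x i\<bar> \<le> norm x"
proof -
  have "inner x (unit_seq i) = coord x i"
    by (subst inner_commute, subst inner_fin_seq_superset[of "{i}"]) (auto simp: coord_unit_seq)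
  moreover have "norm (unit_seq i) = 1"
    by (simp add: norm_eq_sqrt_inner, subst inner_fin_seq_superset[of "{i}"])
      (auto simp: coord_unit_seq)
  ultimately show ?thesis using Cauchy_Schwarz_ineq2[of x "unit_seq i"] by simp
qed

text \<open>The ambient space is infinite-dimensional, so compactness has to come from the subspace.
  Boxes suit an induction on \<open>n\<close>: each one is the Minkowski sum of the previous box and
  a segment in the new direction.\<close>

lemma compact_Rn_box: "compact {x \<in> Rn n. \<forall>i. \<bar>coord x i\<bar> \<le> r}"
proof (cases "r \<ge> 0")
  case True
  then show ?thesis
  proof (induction n)
    case 0
    have "{x \<in> Rn 0. \<forall>i. \<bar>coord x i\<bar> \<le> r} \<subseteq> {0}"
      by (auto simp: Rn_def intro: fin_seq_eqI)
    then show ?case by (meson finite.simps finite_imp_compact finite_subset)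
  next
    case (Suc n)
    let ?K = "\<lambda>n. {x \<in> Rn n. \<forall>i. \<bar>coord x i\<bar> \<le> r}"
    let ?T = "(\<lambda>s. s *\<^sub>R unit_seq n) ` {-r..r}"
    have "compact ?T"
      by (intro compact_continuous_image continuous_intros) auto
    then have "compact {x + y |x y. x \<in> ?K n \<and> y \<in> ?T}"
      using Suc by (intro compact_sums) auto
    also have "{x + y |x y. x \<in> ?K n \<and> y \<in> ?T} = ?K (Suc n)"
    proof (intro equalityI subsetI)
      fix z assume "z \<in> {x + y |x y. x \<in> ?K n \<and> y \<in> ?T}"
      then show "z \<in> ?K (Suc n)" by (auto simp: Rn_def coord_unit_seq abs_le_iff)
    next
      fix z assume z: "z \<in> ?K (Suc n)"
      let ?y = "coord z n *\<^sub>R unit_seq n"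
      have "?y \<in> ?T" using z by (intro imageI) (auto simp: abs_le_iff intro: minus_le_iff[THEN iffD1])
      \<comment> \<open>Removing the last coordinate leaves a 0 there, which meets the bound because
        r is nonnegative.\<close>
      moreover have "z - ?y \<in> ?K n"
        using z True by (auto simp: Rn_def coord_unit_seq not_less_eq_eq[symmetric])
      moreover have "z = (z - ?y) + ?y" by simp
      ultimately show "z \<in> {x + y |x y. x \<in> ?K n \<and> y \<in> ?T}" by blast
    qed
    finally show ?case .
  qed
next
  case False
  then have "{x \<in> Rn n. \<forall>i. \<bar>coord x i\<bar> \<le> r} = {}"
    by auto
  then show ?thesis by (simp only: compact_empty)
qed

text \<open>\<open>minimizer\<close> is a choice term, so a minimum must first be shown to exist. A
  compact box supplies one, and strong convexity at 0 keeps \<open>f\<close> at least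
  \<open>f 0\<close> outside it.\<close>

lemma S1_minimizer_is_arg_min:
  assumes f: "f \<in> S1 n \<mu>" and \<mu>: "\<mu> > 0"
  shows "is_arg_min f (\<lambda>x. x \<in> Rn n) (minimizer n f)"
proof -
  let ?g = "grad n f 0"
  \<comment> \<open>Beyond this radius the quadratic term of the lower bound at 0 dominates the
    linear one.\<close>
  let ?r = "2 * norm ?g / \<mu>"
  let ?K = "{x \<in> Rn n. \<forall>i. \<bar>coord x i\<bar> \<le> ?r}"
  have r: "?r \<ge> 0" using \<mu> by simp
  have 0: "0 \<in> Rn n" by (simp add: Rn_def)
  have "0 \<in> ?K" using 0 r by simp
  moreover have "continuous_on ?K f"
    using C1_continuous_on[OF S1_C1[OF f]] by (rule continuous_on_subset) auto
  ultimately obtain x where x: "x \<in> ?K" and min: "\<And>y. y \<in> ?K \<Longrightarrow> f x \<le> f y"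
    using continuous_attains_inf[OF compact_Rn_box, of n ?r f] by blast
  have "f x \<le> f y" if y: "y \<in> Rn n" for y
  proof (cases "norm y \<le> ?r")
    case True
    then show ?thesis using y abs_coord_le_norm[of y] by (intro min) (auto intro: order_trans)
  next
    case False
    then have "norm ?g \<le> \<mu> / 2 * norm y" using \<mu> by (simp add: field_simps)
    then have "norm ?g * norm y \<le> (\<mu> / 2 * norm y) * norm y" by (intro mult_right_mono) auto
    moreover have "- (norm ?g * norm y) \<le> inner ?g y"
      using Cauchy_Schwarz_ineq2[of ?g y] by linarith
    ultimately have "f 0 \<le> f y"
      using S1_lower_bound[OF f 0 y] by (simp add: power2_eq_square)
    moreover have "f x \<le> f 0" using \<open>0 \<in> ?K\<close> by (rule min)
    ultimately show ?thesis by simp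
  qed
  then have "is_arg_min f (\<lambda>x. x \<in> Rn n) x"
    using x by (auto simp: is_arg_min_linorder)
  then show ?thesis
    unfolding arg_min_on_def arg_min_def by (rule someI)
qed

text \<open>Strong convexity is used at a point \<open>z\<close> of the segment from
  \<open>y\<close> to \<open>x\<close>, tested against both ends. Minimality enters only as
  \<open>f y \<le> f z\<close>; then \<open>z\<close> tends to \<open>y\<close>.\<close>

lemma S1_quadratic_growth:
  assumes f: "f \<in> S1 n \<mu>" and min: "is_arg_min f (\<lambda>x. x \<in> Rn n) y" and x: "x \<in> Rn n"
  shows "\<mu> / 2 * (norm (x - y))\<^sup>2 \<le> f x - f y"
proof -
  have y: "y \<in> Rn n" and le: "\<And>z. z \<in> Rn n \<Longrightarrow> f y \<le> f z"
    using min by (auto simp: is_arg_min_linorder)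
  have *: "(1 - t) * (\<mu> / 2 * (norm (x - y))\<^sup>2) \<le> f x - f y" if t: "0 < t" "t < 1" for t
  proof -
    define z where "z = y + t *\<^sub>R (x - y)"
    have z: "z \<in> Rn n"
      unfolding z_def using x y
      by (intro subspace_add[OF subspace_Rn] subspace_scale[OF subspace_Rn]
          subspace_diff[OF subspace_Rn])
    have xz: "x - z = (1 - t) *\<^sub>R (x - y)" and yz: "y - z = (- t) *\<^sub>R (x - y)"
      by (simp_all add: z_def algebra_simps)
    let ?i = "inner (grad n f z) (x - y)" and ?N = "\<mu> / 2 * (norm (x - y))\<^sup>2"
    have "f z + (1 - t) * ?i + (1 - t)\<^sup>2 * ?N \<le> f x"
      using S1_lower_bound[OF f z x] t by (simp add: xz power_mult_distrib mult_ac)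
    moreover have "f z - t * ?i + t\<^sup>2 * ?N \<le> f y"
      using S1_lower_bound[OF f z y] by (simp add: yz power_mult_distrib mult_ac)
    \<comment> \<open>The weights t and 1 - t cancel the gradient terms, and t(1-t)^2 + (1-t)t^2 =
      t(1-t) remains in front of \<open>?N\<close>.\<close>
    ultimately have "t * (f z + (1 - t) * ?i + (1 - t)\<^sup>2 * ?N)
        + (1 - t) * (f z - t * ?i + t\<^sup>2 * ?N) \<le> t * f x + (1 - t) * f y"
      using t by (intro add_mono mult_left_mono) auto
    then have "f z + t * ((1 - t) * ?N) \<le> f y + t * (f x - f y)"
      by (simp add: field_simps power2_eq_square)
    with le[OF z] have "t * ((1 - t) * ?N) \<le> t * (f x - f y)" by linarith
    with t show ?thesis by simp
  qed
  have "((\<lambda>t. (1 - t) * (\<mu> / 2 * (norm (x - y))\<^sup>2)) \<longlongrightarrow> (1 - 0) * (\<mu> / 2 * (norm (x - y))\<^sup>2))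
      (at_right (0::real))"
    by (intro tendsto_intros)
  moreover have "\<forall>\<^sub>F t in at_right (0::real). (1 - t) * (\<mu> / 2 * (norm (x - y))\<^sup>2) \<le> f x - f y"
    by (rule eventually_mono[OF eventually_at_right_real[OF zero_less_one]]) (use * in simp)
  ultimately have "(1 - 0) * (\<mu> / 2 * (norm (x - y))\<^sup>2) \<le> f x - f y"
    by (intro tendsto_upperbound) auto
  then show ?thesis by simp
qed

subsection \<open>The decay estimate\<close>

text \<open>The rate is the smaller root of s^2 - c1 s + c0 when the roots are real, which gives
  equality in the last bound. Otherwise it is c1/2, and the last bound reads c1^2/4 <= c0.\<close>

lemma decay_rate_bounds:
  assumes "c\<^sub>0 > 0" "c\<^sub>1 > 0"
  shows "0 < decay_rate c\<^sub>0 c\<^sub>1" "2 * decay_rate c\<^sub>0 c\<^sub>1 \<le> c\<^sub>1"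
    "decay_rate c\<^sub>0 c\<^sub>1 * (c\<^sub>1 - decay_rate c\<^sub>0 c\<^sub>1) \<le> c\<^sub>0"
proof -
  define d where "d = max (c\<^sub>1\<^sup>2 - 4 * c\<^sub>0) 0"
  have l: "decay_rate c\<^sub>0 c\<^sub>1 = (c\<^sub>1 - sqrt d) / 2" by (simp add: decay_rate_def d_def)
  have "sqrt d < sqrt (c\<^sub>1\<^sup>2)"
    using assms by (intro real_sqrt_less_mono) (auto simp: d_def)
  then show "0 < decay_rate c\<^sub>0 c\<^sub>1" using assms by (simp add: l)
  have d: "d \<ge> 0" by (simp add: d_def)
  then show "2 * decay_rate c\<^sub>0 c\<^sub>1 \<le> c\<^sub>1" by (simp add: l)
  have "decay_rate c\<^sub>0 c\<^sub>1 * (c\<^sub>1 - decay_rate c\<^sub>0 c\<^sub>1) = (c\<^sub>1\<^sup>2 - (sqrt d)\<^sup>2) / 4"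
    by (simp add: l field_simps power2_eq_square)
  also have "\<dots> \<le> c\<^sub>0" using d by (simp add: d_def)
  finally show "decay_rate c\<^sub>0 c\<^sub>1 * (c\<^sub>1 - decay_rate c\<^sub>0 c\<^sub>1) \<le> c\<^sub>0" .
qed

text \<open>The pointwise algebra behind the decay: \<open>y\<close>, \<open>V\<close>,
  \<open>g\<close>, \<open>F\<close> stand for X - x*, X', the gradient at X and the gap f(X) - f*.
  The left side is the derivative of the Lyapunov function after the equation has eliminated
  X''.\<close>

lemma lyapunov_decrease:
  fixes y V g :: "'a::real_inner"
  assumes m: "m > 0" and l: "l > 0" "2 * l \<le> c\<^sub>1" "l * (c\<^sub>1 - l) \<le> c\<^sub>0"
    and c\<^sub>0: "c\<^sub>0 > 0" and gap: "F + m\<^sup>2 / 2 * inner y y \<le> inner g y"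
  shows "c\<^sub>0 * inner g V + inner (V + (l * m) *\<^sub>R y) ((l * m - c\<^sub>1 * m) *\<^sub>R V - c\<^sub>0 *\<^sub>R g)
      + l * (c\<^sub>1 - 2 * l) * m\<^sup>2 * inner y V
    \<le> (- l * m) * (c\<^sub>0 * F + inner (V + (l * m) *\<^sub>R y) (V + (l * m) *\<^sub>R y) / 2
        + l * (c\<^sub>1 - 2 * l) * m\<^sup>2 / 2 * inner y y)" (is "?lhs \<le> ?rhs")
proof -
  \<comment> \<open>The three summands are nonnegative by \<open>gap\<close>, by 2 l <= c1 and by l
    (c1 - l) <= c0, respectively.\<close>
  have "?rhs - ?lhs = l * m * c\<^sub>0 * (inner g y - F - m\<^sup>2 / 2 * inner y y)
      + (c\<^sub>1 - 3 / 2 * l) * m * inner V V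
      + l * m * m\<^sup>2 / 2 * (c\<^sub>0 - l * (c\<^sub>1 - l)) * inner y y"
    by (simp add: inner_add_left inner_add_right inner_diff_left inner_diff_right
        inner_commute[of V y] inner_commute[of V g] inner_commute[of y g])
      (simp add: field_simps power2_eq_square)
  moreover have "0 \<le> l * m * c\<^sub>0 * (inner g y - F - m\<^sup>2 / 2 * inner y y)"
    using assms by simp
  moreover have "0 \<le> (c\<^sub>1 - 3 / 2 * l) * m * inner V V"
    using assms by (intro mult_nonneg_nonneg) auto
  moreover have "0 \<le> l * m * m\<^sup>2 / 2 * (c\<^sub>0 - l * (c\<^sub>1 - l)) * inner y y"
    using assms by (intro mult_nonneg_nonneg) auto
  ultimately show ?thesis by linarith
qed

lemma solution_decay:
  assumes c: "c\<^sub>0 > 0" "c\<^sub>1 > 0" and \<mu>: "\<mu> > 0" and f: "f \<in> S1 n \<mu>" and x\<^sub>0: "x\<^sub>0 \<in> Rn n"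
    and sol: "is_solution n c\<^sub>0 c\<^sub>1 \<mu> f x\<^sub>0 X" and t: "t \<ge> 0"
  shows "f (X t) - f (minimizer n f)
    \<le> 2 * exp (- decay_rate c\<^sub>0 c\<^sub>1 * sqrt \<mu> * t) * (f x\<^sub>0 - f (minimizer n f))"
proof -
  define m where "m = sqrt \<mu>"
  define l where "l = decay_rate c\<^sub>0 c\<^sub>1"
  define x where "x = minimizer n f"
  have m: "m > 0" "m\<^sup>2 = \<mu>" using \<mu> by (auto simp: m_def)
  note l = decay_rate_bounds[OF c, folded l_def]
  have min: "is_arg_min f (\<lambda>x. x \<in> Rn n) x"
    unfolding x_def by (rule S1_minimizer_is_arg_min[OF f \<mu>])
  then have x: "x \<in> Rn n" by (simp add: is_arg_min_def)
  obtain X' X'' where XR: "\<And>s. s \<ge> 0 \<Longrightarrow> X s \<in> Rn n"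
    and X: "\<And>s. s \<ge> 0 \<Longrightarrow> (X has_vector_derivative X' s) (at s within {0..})"
    and X': "\<And>s. s \<ge> 0 \<Longrightarrow> (X' has_vector_derivative X'' s) (at s within {0..})"
    and ode: "\<And>s. s \<ge> 0 \<Longrightarrow> X'' s + (c\<^sub>1 * m) *\<^sub>R X' s + c\<^sub>0 *\<^sub>R grad n f (X s) = 0"
    and init: "X 0 = x\<^sub>0" "X' 0 = 0"
    using sol unfolding is_solution_def m_def by blast
  define \<kappa> where "\<kappa> = l * (c\<^sub>1 - 2 * l) * m\<^sup>2"
  have \<kappa>: "\<kappa> \<ge> 0" using l by (simp add: \<kappa>_def)
  define W where "W s = X' s + (l * m) *\<^sub>R (X s - x)" for s
  define E where "E s = c\<^sub>0 * (f (X s) - f x) + inner (W s) (W s) / 2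
      + \<kappa> / 2 * inner (X s - x) (X s - x)" for s
  define E' where "E' s = c\<^sub>0 * inner (grad n f (X s)) (X' s)
      + inner (W s) ((l * m - c\<^sub>1 * m) *\<^sub>R X' s - c\<^sub>0 *\<^sub>R grad n f (X s))
      + \<kappa> * inner (X s - x) (X' s)" for s
  have "(E has_real_derivative E' s) (at s within {0..})" if s: "s \<ge> 0" for s
  proof -
    \<comment> \<open>\<open>f\<close> is differentiable only within \<open>Rn n\<close>, so the
      chain rule is applied within the image of the trajectory.\<close>
    have "(f has_derivative inner (grad n f (X s))) (at (X s) within X ` {0..})"
      by (rule has_derivative_subset[OF C1_has_derivative[OF S1_C1[OF f] XR[OF s]]])
        (auto intro: XR)
    from has_derivative_in_compose[OF X[OF s, unfolded has_vector_derivative_def] this]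
    have fX: "((\<lambda>s. f (X s)) has_derivative (\<lambda>h. inner (grad n f (X s)) (h *\<^sub>R X' s)))
        (at s within {0..})" .
    have X''_eq: "X'' s = - ((c\<^sub>1 * m) *\<^sub>R X' s) - c\<^sub>0 *\<^sub>R grad n f (X s)"
      using ode[OF s] by (simp add: algebra_simps eq_neg_iff_add_eq_0)
    have W: "(W has_derivative (\<lambda>h. h *\<^sub>R ((l * m - c\<^sub>1 * m) *\<^sub>R X' s - c\<^sub>0 *\<^sub>R grad n f (X s))))
        (at s within {0..})"
      unfolding W_def
      by (rule derivative_eq_intros X[OF s, unfolded has_vector_derivative_def]
          X'[OF s, unfolded has_vector_derivative_def] refl)+
        (simp add: X''_eq algebra_simps)
    have "((\<lambda>s. f (X s)) has_real_derivative inner (grad n f (X s)) (X' s)) (at s within {0..})"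
      using fX by (simp add: has_field_derivative_def mult_commute_abs)
    moreover have "((\<lambda>s. inner (W s) (W s)) has_real_derivative
        2 * inner (W s) ((l * m - c\<^sub>1 * m) *\<^sub>R X' s - c\<^sub>0 *\<^sub>R grad n f (X s))) (at s within {0..})"
      unfolding has_field_derivative_def
      by (rule has_derivative_eq_rhs[OF has_derivative_inner[OF W W]])
        (simp add: fun_eq_iff inner_commute)
    moreover have "((\<lambda>s. inner (X s - x) (X s - x)) has_real_derivative 2 * inner (X s - x) (X' s))
        (at s within {0..})"
    proof -
      have "((\<lambda>s. X s - x) has_derivative (\<lambda>h. h *\<^sub>R X' s)) (at s within {0..})"
        using X[OF s] unfolding has_vector_derivative_def by (auto intro!: derivative_eq_intros)
      from has_derivative_eq_rhs[OF has_derivative_inner[OF this this]] show ?thesis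
        by (simp add: has_field_derivative_def fun_eq_iff inner_commute)
    qed
    ultimately show ?thesis
      unfolding E_def E'_def by (auto intro!: derivative_eq_intros)
  qed
  moreover have "E' s \<le> (- l * m) * E s" if s: "s \<ge> 0" for s
    unfolding E'_def E_def W_def \<kappa>_def
  proof (rule lyapunov_decrease[OF m(1) l c(1)])
    \<comment> \<open>This is strong convexity at \<open>X s\<close>, tested at the
      minimizer.\<close>
    show "f (X s) - f x + m\<^sup>2 / 2 * inner (X s - x) (X s - x) \<le> inner (grad n f (X s)) (X s - x)"
      using S1_lower_bound[OF f XR[OF s] x]
      by (simp add: m(2) norm_minus_commute[of x] power2_norm_eq_inner inner_diff_right)
  qed
  ultimately have "E t \<le> exp ((- l * m) * t) * E 0"
    using t by (rule gronwall_exp_bound)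
  moreover have "c\<^sub>0 * (f (X t) - f x) \<le> E t"
    using \<kappa> by (simp add: E_def)
  moreover have "E 0 \<le> 2 * c\<^sub>0 * (f x\<^sub>0 - f x)"
  proof -
    define v where "v = x\<^sub>0 - x"
    let ?N = "\<mu> / 2 * (norm v)\<^sup>2"
    \<comment> \<open>The initial velocity is 0, so both quadratic terms are multiples of |v|^2,
      with l^2 + l (c1 - 2 l) = l (c1 - l).\<close>
    have "E 0 = c\<^sub>0 * (f x\<^sub>0 - f x) + l * (c\<^sub>1 - l) * ?N"
      unfolding E_def W_def \<kappa>_def init power2_norm_eq_inner m(2)[symmetric] v_def[symmetric]
      by (simp add: field_simps power2_eq_square)
    also have "l * (c\<^sub>1 - l) * ?N \<le> c\<^sub>0 * (f x\<^sub>0 - f x)"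
      using l c \<mu> S1_quadratic_growth[OF f min x\<^sub>0, folded v_def] by (intro mult_mono) auto
    finally show ?thesis by simp
  qed
  ultimately have "c\<^sub>0 * (f (X t) - f x) \<le> exp ((- l * m) * t) * (2 * c\<^sub>0 * (f x\<^sub>0 - f x))"
    by (meson exp_ge_zero mult_left_mono order_trans)
  then have "c\<^sub>0 * (f (X t) - f x) \<le> c\<^sub>0 * (2 * exp (- l * m * t) * (f x\<^sub>0 - f x))"
    by (simp only: mult_ac)
  with c(1) show ?thesis by (simp add: l_def m_def x_def)
qed

subsection \<open>Quadratic counterexamples\<close>

lemma grad_quadratic:
  assumes "x \<in> Rn n"
  shows "has_gradient n (\<lambda>x. L / 2 * (norm x)\<^sup>2) x (L *\<^sub>R x)"
    and "grad n (\<lambda>x. L / 2 * (norm x)\<^sup>2) x = L *\<^sub>R x"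
proof -
  have "((\<lambda>x. L / 2 * inner x x) has_derivative inner (L *\<^sub>R x)) (at x within Rn n)"
    by (auto intro!: derivative_eq_intros simp: inner_commute algebra_simps)
  then show "has_gradient n (\<lambda>x. L / 2 * (norm x)\<^sup>2) x (L *\<^sub>R x)"
    unfolding has_gradient_def power2_norm_eq_inner
    using subspace_scale[OF subspace_Rn assms] by blast
  then show "grad n (\<lambda>x. L / 2 * (norm x)\<^sup>2) x = L *\<^sub>R x"
    by (rule grad_eq[OF assms])
qed

lemma quadratic_in_S1:
  assumes "\<mu> \<le> L"
  shows "(\<lambda>x. L / 2 * (norm x)\<^sup>2) \<in> S1 n \<mu>"
proof -
  let ?f = "\<lambda>x::fin_seq. L / 2 * (norm x)\<^sup>2"
  have "continuous_on (Rn n) (\<lambda>x. L *\<^sub>R x)"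
    by (intro continuous_intros)
  then have "continuous_on (Rn n) (grad n ?f)"
    by (rule continuous_on_cong[THEN iffD1, rotated -1]) (simp_all only: grad_quadratic(2))
  then have "C1 n ?f" using grad_quadratic(1) by (auto simp: C1_def)
  moreover have "?f x + inner (grad n ?f x) (y - x) + \<mu> / 2 * (norm (y - x))\<^sup>2 \<le> ?f y"
    if "x \<in> Rn n" for x y
  proof -
    have "?f y - ?f x - inner (grad n ?f x) (y - x) = L / 2 * (norm (y - x))\<^sup>2"
      by (subst grad_quadratic(2)[OF that], simp add: power2_norm_eq_inner)
        (simp add: inner_diff_left inner_diff_right inner_commute[of y x] field_simps)
    moreover have "\<mu> / 2 * (norm (y - x))\<^sup>2 \<le> L / 2 * (norm (y - x))\<^sup>2"
      using assms by (intro mult_right_mono) auto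
    ultimately show ?thesis by linarith
  qed
  ultimately show ?thesis by (auto simp: S1_def)
qed

lemma minimizer_quadratic:
  assumes "L > 0"
  shows "minimizer n (\<lambda>x. L / 2 * (norm x)\<^sup>2) = 0"
proof -
  let ?f = "\<lambda>x::fin_seq. L / 2 * (norm x)\<^sup>2"
  have "is_arg_min ?f (\<lambda>x. x \<in> Rn n) (minimizer n ?f)"
    \<comment> \<open>The modulus of strong convexity is taken to be \<open>L\<close>
      itself.\<close>
    using assms by (intro S1_minimizer_is_arg_min[OF quadratic_in_S1[OF order_refl]])
  moreover have "0 \<in> Rn n" by (simp add: Rn_def)
  ultimately have "?f (minimizer n ?f) \<le> ?f 0" by (auto simp: is_arg_min_linorder)
  then have "(norm (minimizer n ?f))\<^sup>2 \<le> 0"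
    using assms by (simp add: mult_le_0_iff)
  then show ?thesis by simp
qed

text \<open>The characteristic roots are a + iw and a - iw with a = -b/2 >= 0, so the oscillation is
  not damped.\<close>

lemma oscillator_nonconvergent:
  fixes b c :: real
  assumes b: "b \<le> 0" and d: "b\<^sup>2 < 4 * c"
  obtains u u' u'' :: "real \<Rightarrow> real" where
    "\<And>t. (u has_real_derivative u' t) (at t)" "\<And>t. (u' has_real_derivative u'' t) (at t)"
    "\<And>t. u'' t + b * u' t + c * u t = 0" "u 0 = 1" "u' 0 = 0" "\<not> (u \<longlongrightarrow> 0) at_top"
proof -
  define a where "a = - b / 2"
  define w where "w = sqrt (c - a\<^sup>2)"
  have a: "a \<ge> 0" using b by (simp add: a_def)
  have "c - a\<^sup>2 > 0" using d by (simp add: a_def power_divide)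
  then have w: "w > 0" and w2: "c = w\<^sup>2 + a\<^sup>2" by (auto simp: w_def)
  \<comment> \<open>The sine coefficient is the one that makes the initial velocity vanish.\<close>
  define u where "u t = exp (a * t) * (cos (w * t) - a / w * sin (w * t))" for t
  define u' where "u' t = exp (a * t) * (- (c / w) * sin (w * t))" for t
  define u'' where "u'' t = exp (a * t) * (- (c / w) * (a * sin (w * t) + w * cos (w * t)))" for t
  have "(u has_real_derivative u' t) (at t)" for t
    unfolding u_def u'_def w2 using w
    by (auto intro!: derivative_eq_intros) (simp add: field_simps power2_eq_square)
  moreover have "(u' has_real_derivative u'' t) (at t)" for t
    unfolding u'_def u''_def using w
    by (auto intro!: derivative_eq_intros) (simp add: field_simps power2_eq_square)
  moreover have "u'' t + b * u' t + c * u t = 0" for t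
  proof -
    have "b = - 2 * a" by (simp add: a_def)
    then show ?thesis
      unfolding u_def u'_def u''_def using w by (simp add: field_simps)
  qed
  moreover have "u 0 = 1" "u' 0 = 0" by (simp_all add: u_def u'_def)
  moreover have "\<not> (u \<longlongrightarrow> 0) at_top"
  proof
    assume "(u \<longlongrightarrow> 0) at_top"
    then have "\<forall>\<^sub>F t in at_top. u t < 1" by (rule order_tendstoD) simp
    then obtain N where N: "\<And>t. t \<ge> N \<Longrightarrow> u t < 1" by (auto simp: eventually_at_top_linorder)
    \<comment> \<open>At the full periods t = 2 pi k / w the sine vanishes and the cosine is 1, so
      \<open>u t = exp (a * t)\<close>, which is at least 1.\<close>
    obtain k :: nat where k: "N * w / (2 * pi) \<le> real k" using real_arch_simple by blast
    define t where "t = real k * (2 * pi) / w"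
    have "N \<le> t" using k w by (simp add: t_def field_simps)
    have "w * t = 2 * real k * pi" using w by (simp add: t_def)
    then have "u t = exp (a * t)" by (simp only: u_def cos_2npi sin_2npi) simp
    moreover have "t \<ge> 0" using w by (simp add: t_def)
    ultimately have "u t \<ge> 1" using a by simp
    with N[OF \<open>N \<le> t\<close>] show False by simp
  qed
  ultimately show thesis by (rule that)
qed

text \<open>For \<open>c < 0\<close> the characteristic roots are q > 0 and -p < 0, and the growing
  mode enters with a positive weight. For \<open>c = 0\<close> the constant 1 is a solution.\<close>

lemma repulsive_nonconvergent:
  fixes b c :: real
  assumes c: "c \<le> 0"
  obtains u u' u'' :: "real \<Rightarrow> real" where
    "\<And>t. (u has_real_derivative u' t) (at t)" "\<And>t. (u' has_real_derivative u'' t) (at t)"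
    "\<And>t. u'' t + b * u' t + c * u t = 0" "u 0 = 1" "u' 0 = 0" "\<not> (u \<longlongrightarrow> 0) at_top"
proof (cases "c = 0")
  case True
  show thesis
    by (rule that[of "\<lambda>_. 1" "\<lambda>_. 0" "\<lambda>_. 0"]) (simp_all add: True tendsto_const_iff)
next
  case False
  define d where "d = sqrt (b\<^sup>2 - 4 * c)"
  define p where "p = (d + b) / 2"
  define q where "q = (d - b) / 2"
  have "\<bar>b\<bar> < d"
    unfolding d_def using c False by (intro real_less_rsqrt) simp
  then have p: "p > 0" and q: "q > 0" by (auto simp: p_def q_def)
  have "0 \<le> b\<^sup>2 - 4 * c" using c zero_le_power2[of b] by linarith
  then have "d\<^sup>2 = b\<^sup>2 - 4 * c" by (simp add: d_def)
  then have "p * q = - c"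
    by (simp add: p_def q_def field_simps power2_eq_square)
  then have cpq: "c = - (p * q)" and bpq: "b = p - q" by (simp_all add: p_def q_def field_simps)
  define k where "k = 1 / (p + q)"
  have k: "k > 0" "k * (p + q) = 1" using p q by (simp_all add: k_def)
  \<comment> \<open>The weights q and p give initial velocity 0, and k normalizes the initial value
    to 1.\<close>
  define u where "u t = k * (q * exp (- p * t) + p * exp (q * t))" for t
  define u' where "u' t = k * (p * q * (exp (q * t) - exp (- p * t)))" for t
  define u'' where "u'' t = k * (p * q * (q * exp (q * t) + p * exp (- p * t)))" for t
  have "(u has_real_derivative u' t) (at t)" for t
    unfolding u_def u'_def by (auto intro!: derivative_eq_intros simp: algebra_simps)
  moreover have "(u' has_real_derivative u'' t) (at t)" for t
    unfolding u'_def u''_def by (auto intro!: derivative_eq_intros simp: algebra_simps)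
  moreover have "u'' t + b * u' t + c * u t = 0" for t
    unfolding u_def u'_def u''_def cpq bpq by (simp add: algebra_simps)
  moreover have "u 0 = 1" "u' 0 = 0" using k(2) by (simp_all add: u_def u'_def add.commute)
  moreover have "\<not> (u \<longlongrightarrow> 0) at_top"
  proof
    assume u: "(u \<longlongrightarrow> 0) at_top"
    have "k * p \<le> u t" if "t \<ge> 0" for t
    proof -
      have "p * 1 \<le> p * exp (q * t)" using p q that by (intro mult_left_mono) auto
      moreover have "0 \<le> q * exp (- p * t)" using q by simp
      ultimately have "p \<le> q * exp (- p * t) + p * exp (q * t)" by linarith
      then show ?thesis unfolding u_def using k(1) by simp
    qed
    then have "\<forall>\<^sub>F t in at_top. k * p \<le> u t"
      by (auto simp: eventually_at_top_linorder)
    with u have "k * p \<le> 0" by (intro tendsto_lowerbound) auto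
    with k(1) p show False by (simp add: mult_le_0_iff)
  qed
  ultimately show thesis by (rule that)
qed

text \<open>A scalar solution times a unit vector solves the vector equation, since the gradient of
  the quadratic is \<open>L\<close> times the identity. This shows that a solution exists;
  uniqueness then covers all solutions.\<close>

lemma quadratic_solution_nonconvergent:
  fixes u u' u'' :: "real \<Rightarrow> real"
  assumes n: "n \<ge> 1" and \<mu>: "\<mu> > 0" and L: "\<mu> \<le> L"
    and u: "\<And>t. (u has_real_derivative u' t) (at t)"
    and u': "\<And>t. (u' has_real_derivative u'' t) (at t)"
    and ode: "\<And>t. u'' t + (c\<^sub>1 * sqrt \<mu>) * u' t + (c\<^sub>0 * L) * u t = 0"
    and init: "u 0 = 1" "u' 0 = 0"
    and lim: "\<not> (u \<longlongrightarrow> 0) at_top"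
  shows "\<exists>f\<in>S1 n \<mu>. \<exists>x\<^sub>0\<in>Rn n. (\<exists>X. is_solution n c\<^sub>0 c\<^sub>1 \<mu> f x\<^sub>0 X) \<and>
    (\<forall>X. is_solution n c\<^sub>0 c\<^sub>1 \<mu> f x\<^sub>0 X \<longrightarrow> \<not> (X \<longlongrightarrow> minimizer n f) at_top)"
proof -
  let ?f = "\<lambda>x::fin_seq. L / 2 * (norm x)\<^sup>2"
  define e where "e = unit_seq 0"
  have e: "e \<in> Rn n" using n by (simp add: e_def Rn_def coord_unit_seq)
  have Re: "u t *\<^sub>R e \<in> Rn n" for t by (rule subspace_scale[OF subspace_Rn e])
  have ue: "((\<lambda>t. u t *\<^sub>R e) has_vector_derivative u' t *\<^sub>R e) (at t within S)"
    "((\<lambda>t. u' t *\<^sub>R e) has_vector_derivative u'' t *\<^sub>R e) (at t within S)" for t S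
    using has_field_derivative_at_within[OF u] has_field_derivative_at_within[OF u']
    by (auto intro!: derivative_eq_intros)
  have ode_e: "u'' t *\<^sub>R e + (c\<^sub>1 * sqrt \<mu>) *\<^sub>R (u' t *\<^sub>R e) + (c\<^sub>0 * L) *\<^sub>R (u t *\<^sub>R e) = 0" for t
    by (simp only: scaleR_scaleR scaleR_add_left[symmetric] ode scaleR_zero_left)
  have sol: "u'' t *\<^sub>R e + (c\<^sub>1 * sqrt \<mu>) *\<^sub>R (u' t *\<^sub>R e) + c\<^sub>0 *\<^sub>R grad n ?f (u t *\<^sub>R e) = 0" for t
    unfolding grad_quadratic(2)[OF Re] using ode_e[of t] by (simp add: mult.assoc)
  have "is_solution n c\<^sub>0 c\<^sub>1 \<mu> ?f e (\<lambda>t. u t *\<^sub>R e)"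
    unfolding is_solution_def
  proof (rule conjI[OF _ exI[of _ "\<lambda>t. u' t *\<^sub>R e", OF exI[of _ "\<lambda>t. u'' t *\<^sub>R e"]]], goal_cases)
    case 2
    show ?case by (intro conjI allI impI ue sol) (simp_all add: init)
  qed (simp add: Re)
  moreover have "\<not> (X \<longlongrightarrow> minimizer n ?f) at_top" if solX: "is_solution n c\<^sub>0 c\<^sub>1 \<mu> ?f e X" for X
  proof
    assume "(X \<longlongrightarrow> minimizer n ?f) at_top"
    moreover have "minimizer n ?f = 0" using \<mu> L by (intro minimizer_quadratic) simp
    ultimately have X0: "((\<lambda>t. norm (X t)) \<longlongrightarrow> 0) at_top" by (simp add: tendsto_norm_zero)
    obtain X' X'' where XR: "\<And>t. t \<ge> 0 \<Longrightarrow> X t \<in> Rn n"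
      and X: "\<And>t. t \<ge> 0 \<Longrightarrow> (X has_vector_derivative X' t) (at t within {0..})"
      and X': "\<And>t. t \<ge> 0 \<Longrightarrow> (X' has_vector_derivative X'' t) (at t within {0..})"
      and odeX: "\<And>t. t \<ge> 0 \<Longrightarrow>
        X'' t + (c\<^sub>1 * sqrt \<mu>) *\<^sub>R X' t + c\<^sub>0 *\<^sub>R grad n ?f (X t) = 0"
      and initX: "X 0 = e" "X' 0 = 0"
      using solX unfolding is_solution_def by blast
    \<comment> \<open>The difference of two solutions solves the linear equation with zero initial
      data.\<close>
    have "X t - u t *\<^sub>R e = 0" if t: "t \<ge> 0" for t
    proof (rule damped_linear_ode_zero[OF _ _ _ _ _ t])
      fix s :: real assume s: "s \<ge> 0"
      show "((\<lambda>t. X t - u t *\<^sub>R e) has_vector_derivative X' s - u' s *\<^sub>R e) (at s within {0..})"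
        by (intro has_vector_derivative_diff X s ue)
      show "((\<lambda>t. X' t - u' t *\<^sub>R e) has_vector_derivative X'' s - u'' s *\<^sub>R e) (at s within {0..})"
        by (intro has_vector_derivative_diff X' s ue)
      have "X'' s + (c\<^sub>1 * sqrt \<mu>) *\<^sub>R X' s + (c\<^sub>0 * L) *\<^sub>R X s = 0"
        using odeX[OF s] unfolding grad_quadratic(2)[OF XR[OF s]] by simp
      then have "(X'' s + (c\<^sub>1 * sqrt \<mu>) *\<^sub>R X' s + (c\<^sub>0 * L) *\<^sub>R X s)
          - (u'' s *\<^sub>R e + (c\<^sub>1 * sqrt \<mu>) *\<^sub>R (u' s *\<^sub>R e) + (c\<^sub>0 * L) *\<^sub>R (u s *\<^sub>R e)) = 0"
        unfolding ode_e by simp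
      then show "(X'' s - u'' s *\<^sub>R e) + (c\<^sub>1 * sqrt \<mu>) *\<^sub>R (X' s - u' s *\<^sub>R e)
          + (c\<^sub>0 * L) *\<^sub>R (X s - u s *\<^sub>R e) = 0"
        by (simp only: scaleR_diff_right) (simp add: algebra_simps)
    qed (simp_all add: init initX)
    then have "\<bar>u t\<bar> \<le> norm (X t)" if "t \<ge> 0" for t
      using that abs_coord_le_norm[of "X t" 0] by (simp add: e_def coord_unit_seq)
    then have "\<forall>\<^sub>F t in at_top. norm (u t) \<le> norm (X t)"
      by (auto simp: eventually_at_top_linorder)
    from Lim_null_comparison[OF this X0] lim show False by blast
  qed
  ultimately show ?thesis using quadratic_in_S1[OF L] e by blast
qed

section \<open>Combination of the estimate with the counterexamples\<close>

theorem proposition1: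
  fixes c\<^sub>0 c\<^sub>1 :: real
  shows
    "(c\<^sub>0 > 0 \<and> c\<^sub>1 > 0 \<longrightarrow>
       decay_rate c\<^sub>0 c\<^sub>1 > 0 \<and>
       (\<exists>C'>0. \<forall>(n::nat) (\<mu>::real). n \<ge> 1 \<longrightarrow> \<mu> > 0 \<longrightarrow>
         (\<forall>f\<in>S1 n \<mu>. \<forall>x\<^sub>0\<in>Rn n. \<forall>X. is_solution n c\<^sub>0 c\<^sub>1 \<mu> f x\<^sub>0 X \<longrightarrow>
           (\<forall>t\<ge>0. f (X t) - f (minimizer n f)
              \<le> C' * exp (- decay_rate c\<^sub>0 c\<^sub>1 * sqrt \<mu> * t) * (f x\<^sub>0 - f (minimizer n f)))))) \<and>
     (c\<^sub>0 \<le> 0 \<or> c\<^sub>1 \<le> 0 \<longrightarrow>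
       (\<forall>(n::nat) (\<mu>::real). n \<ge> 1 \<longrightarrow> \<mu> > 0 \<longrightarrow>
         (\<exists>f\<in>S1 n \<mu>. \<exists>x\<^sub>0\<in>Rn n.
           (\<exists>X. is_solution n c\<^sub>0 c\<^sub>1 \<mu> f x\<^sub>0 X) \<and>
           (\<forall>X. is_solution n c\<^sub>0 c\<^sub>1 \<mu> f x\<^sub>0 X \<longrightarrow>
             \<not> (X \<longlongrightarrow> minimizer n f) at_top))))"
proof (intro conjI impI allI)
  assume "c\<^sub>0 > 0 \<and> c\<^sub>1 > 0"
  then have c: "c\<^sub>0 > 0" "c\<^sub>1 > 0" by auto
  show "decay_rate c\<^sub>0 c\<^sub>1 > 0" by (rule decay_rate_bounds(1)[OF c])
  show "\<exists>C'>0. \<forall>(n::nat) (\<mu>::real). n \<ge> 1 \<longrightarrow> \<mu> > 0 \<longrightarrow>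
         (\<forall>f\<in>S1 n \<mu>. \<forall>x\<^sub>0\<in>Rn n. \<forall>X. is_solution n c\<^sub>0 c\<^sub>1 \<mu> f x\<^sub>0 X \<longrightarrow>
           (\<forall>t\<ge>0. f (X t) - f (minimizer n f)
              \<le> C' * exp (- decay_rate c\<^sub>0 c\<^sub>1 * sqrt \<mu> * t) * (f x\<^sub>0 - f (minimizer n f))))"
    \<comment> \<open>The constant 2 is uniform in the dimension, \<open>\<mu>\<close>, the function
      and the starting point.\<close>
    using solution_decay[OF c] by (intro exI[of _ 2]) auto
next
  fix n :: nat and \<mu> :: real
  assume c: "c\<^sub>0 \<le> 0 \<or> c\<^sub>1 \<le> 0" and n: "n \<ge> 1" and \<mu>: "\<mu> > 0"
  let ?goal = "\<exists>f\<in>S1 n \<mu>. \<exists>x\<^sub>0\<in>Rn n. (\<exists>X. is_solution n c\<^sub>0 c\<^sub>1 \<mu> f x\<^sub>0 X) \<and>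
    (\<forall>X. is_solution n c\<^sub>0 c\<^sub>1 \<mu> f x\<^sub>0 X \<longrightarrow> \<not> (X \<longlongrightarrow> minimizer n f) at_top)"
  show ?goal
  proof (cases "c\<^sub>0 \<le> 0")
    case True
    \<comment> \<open>Here curvature L = \<open>\<mu>\<close> suffices: the force term is already
      repulsive or zero.\<close>
    then have "c\<^sub>0 * \<mu> \<le> 0" using \<mu> by (simp add: mult_nonpos_nonneg)
    from repulsive_nonconvergent[OF this, where b = "c\<^sub>1 * sqrt \<mu>"]
    obtain u u' u'' where u: "\<And>t. (u has_real_derivative u' t) (at t)"
      "\<And>t. (u' has_real_derivative u'' t) (at t)"
      "\<And>t. u'' t + (c\<^sub>1 * sqrt \<mu>) * u' t + (c\<^sub>0 * \<mu>) * u t = 0"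
      "u 0 = 1" "u' 0 = 0" "\<not> (u \<longlongrightarrow> 0) at_top" by metis
    show ?goal by (rule quadratic_solution_nonconvergent[OF n \<mu> order_refl u])
  next
    case False
    \<comment> \<open>This makes 4 c0 L = 4 c0 \<open>\<mu>\<close> + 4 c1^2 \<open>\<mu>\<close>,
      which exceeds the squared damping c1^2 \<open>\<mu>\<close>, so the roots are complex.\<close>
    define L where "L = \<mu> * (1 + c\<^sub>1\<^sup>2 / c\<^sub>0)"
    have L: "\<mu> \<le> L" using False \<mu> by (simp add: L_def)
    have b: "c\<^sub>1 * sqrt \<mu> \<le> 0" using c False \<mu> by (simp add: mult_nonpos_nonneg)
    have "4 * (c\<^sub>0 * L) - (c\<^sub>1 * sqrt \<mu>)\<^sup>2 = 4 * c\<^sub>0 * \<mu> + 3 * (c\<^sub>1\<^sup>2 * \<mu>)"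
      using False \<mu> by (simp add: L_def field_simps power_mult_distrib)
    moreover have "0 < 4 * c\<^sub>0 * \<mu> + 3 * (c\<^sub>1\<^sup>2 * \<mu>)"
      using False \<mu> by (intro add_pos_nonneg) auto
    ultimately have "(c\<^sub>1 * sqrt \<mu>)\<^sup>2 < 4 * (c\<^sub>0 * L)" by linarith
    from oscillator_nonconvergent[OF b this]
    obtain u u' u'' where u: "\<And>t. (u has_real_derivative u' t) (at t)"
      "\<And>t. (u' has_real_derivative u'' t) (at t)"
      "\<And>t. u'' t + (c\<^sub>1 * sqrt \<mu>) * u' t + (c\<^sub>0 * L) * u t = 0"
      "u 0 = 1" "u' 0 = 0" "\<not> (u \<longlongrightarrow> 0) at_top" by metis
    show ?goal by (rule quadratic_solution_nonconvergent[OF n \<mu> L u])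
  qed
qed

end
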